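(* Let $F$ be a left $E$-Ehresmann monoid and let $M$ be a monoid subsemigroup of $F$ such that: (1) there exists a unary operation $x\mapsto x^*$ on $F$ with $x^*\in E$ for all $x\in F$, such that whenever $t,x\in M$ and $e=tx$ satisfies $e=e^2\in E$, then $e=t^+x^*$; (2) whenever $t,x,s,w\in M$ satisfy $tx\in E$ and $wt=ws$, then $sx\in E$; (3) there exist elements $a,b\in M$ such that (i) the elements $b,ab,a^2b,\ldots$ are pairwise incomparable under the preorder $\leq_{\widetilde{\mathcal R}_E}$ of $F$; (ii) for each $i\ge 0$ we have $M\cap(E_{i+1}\setminus E_i)\neq\emptyset$, where $E_i:=\{f\in E: a^ibf=a^ib\}$; (iii) for each $i\ge 0$ and all $s,t\in M$, if $a^ibs=a^ibt$ and $a^ibt^+=a^ib$, then $a^ibs^+=a^ib$. Then $M$ is not right coherent.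
   Context: Let $S$ be a monoid and $E$ a set of idempotents of $S$. Define a preorder on $S$ by $a\leq_{\widetilde{\mathcal R}_E} b$ if and only if $\{e\in E: eb=b\}\subseteq\{e\in E: ea=a\}$, and let $\widetilde{\mathcal R}_E$ be the associated equivalence relation. $S$ is left $E$-Ehresmann if $E$ is a semilattice (a commutative subsemigroup of idempotents), every $\widetilde{\mathcal R}_E$-class of $S$ contains exactly one element of $E$, and $\widetilde{\mathcal R}_E$ is a left congruence; $a^+$ denotes the unique element of $E$ in the $\widetilde{\mathcal R}_E$-class of $a$. A monoid subsemigroup of $F$ is a subsemigroup of $F$ that is itself a monoid (its identity need not be that of $F$). By convention $a^0b=b$. A right $S$-act is a set with a unital associative right action of the monoid $S$. It is finitely presented if it is isomorphic to a quotient of a free right $S$-act on a finite set by a finitely generated right $S$-act congruence. A monoid $S$ is right coherent if every finitely generated subact of every finitely presented right $S$-act is finitely presented. *)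

theory Defs
  imports Complex_Main "HOL-Algebra.Group"
begin

section \<open>Left Ehresmann monoids\<close>

definition Rtilde_le :: "('a, 'm) monoid_scheme \<Rightarrow> 'a set \<Rightarrow> 'a \<Rightarrow> 'a \<Rightarrow> bool" where
  "Rtilde_le S E a b \<longleftrightarrow>
     {e \<in> E. e \<otimes>\<^bsub>S\<^esub> b = b} \<subseteq> {e \<in> E. e \<otimes>\<^bsub>S\<^esub> a = a}"

definition Rtilde :: "('a, 'm) monoid_scheme \<Rightarrow> 'a set \<Rightarrow> ('a \<times> 'a) set" where
  "Rtilde S E =
     {(a, b) \<in> carrier S \<times> carrier S. Rtilde_le S E a b \<and> Rtilde_le S E b a}"

locale left_Ehresmann = monoid S for S :: "('a, 'm) monoid_scheme" (structure) +
  fixes E :: "'a set"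
  assumes E_subset: "E \<subseteq> carrier S"
    and E_idem: "e \<in> E \<Longrightarrow> e \<otimes> e = e"
    and E_closed: "\<lbrakk>e \<in> E; f \<in> E\<rbrakk> \<Longrightarrow> e \<otimes> f \<in> E"
    and E_comm: "\<lbrakk>e \<in> E; f \<in> E\<rbrakk> \<Longrightarrow> e \<otimes> f = f \<otimes> e"
    and E_unique: "C \<in> carrier S // Rtilde S E \<Longrightarrow> \<exists>!e. e \<in> E \<inter> C"
    and Rtilde_left_cong:
      "\<lbrakk>(a, b) \<in> Rtilde S E; c \<in> carrier S\<rbrakk> \<Longrightarrow> (c \<otimes> a, c \<otimes> b) \<in> Rtilde S E"

definition Eplus :: "('a, 'm) monoid_scheme \<Rightarrow> 'a set \<Rightarrow> 'a \<Rightarrow> 'a" where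
  "Eplus S E a = (THE e. e \<in> E \<and> (a, e) \<in> Rtilde S E)"


section \<open>Monoid subsemigroups\<close>

definition submonoid_with_one ::
    "('a, 'm) monoid_scheme \<Rightarrow> 'a set \<Rightarrow> 'a \<Rightarrow> ('a, 'm) monoid_scheme" where
  "submonoid_with_one F M u = F\<lparr>carrier := M, one := u\<rparr>"

text \<open>The identity \<open>u\<close> of \<open>M\<close> need not be the identity of \<open>F\<close>.\<close>

definition monoid_subsemigroup :: "('a, 'm) monoid_scheme \<Rightarrow> 'a set \<Rightarrow> 'a \<Rightarrow> bool" where
  "monoid_subsemigroup F M u \<longleftrightarrow> M \<subseteq> carrier F \<and> monoid (submonoid_with_one F M u)"


section \<open>Right acts\<close>

locale right_act = monoid S for S :: "('a, 'm) monoid_scheme" (structure) +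
  fixes X :: "'x set" and act :: "'x \<Rightarrow> 'a \<Rightarrow> 'x"
  assumes act_closed: "\<lbrakk>x \<in> X; s \<in> carrier S\<rbrakk> \<Longrightarrow> act x s \<in> X"
    and act_one: "x \<in> X \<Longrightarrow> act x \<one> = x"
    and act_assoc:
      "\<lbrakk>x \<in> X; s \<in> carrier S; t \<in> carrier S\<rbrakk> \<Longrightarrow> act (act x s) t = act x (s \<otimes> t)"

definition act_iso ::
    "('a, 'm) monoid_scheme \<Rightarrow> 'x set \<Rightarrow> ('x \<Rightarrow> 'a \<Rightarrow> 'x) \<Rightarrow>
     'y set \<Rightarrow> ('y \<Rightarrow> 'a \<Rightarrow> 'y) \<Rightarrow> bool" where
  "act_iso S X act Y act' \<longleftrightarrow>
     (\<exists>f. bij_betw f X Y \<and> (\<forall>x\<in>X. \<forall>s\<in>carrier S. f (act x s) = act' (f x) s))"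

definition subact ::
    "('a, 'm) monoid_scheme \<Rightarrow> 'x set \<Rightarrow> ('x \<Rightarrow> 'a \<Rightarrow> 'x) \<Rightarrow> 'x set \<Rightarrow> bool" where
  "subact S X act Y \<longleftrightarrow> Y \<subseteq> X \<and> (\<forall>y\<in>Y. \<forall>s\<in>carrier S. act y s \<in> Y)"

definition fg_subact ::
    "('a, 'm) monoid_scheme \<Rightarrow> 'x set \<Rightarrow> ('x \<Rightarrow> 'a \<Rightarrow> 'x) \<Rightarrow> 'x set \<Rightarrow> bool" where
  "fg_subact S X act Y \<longleftrightarrow>
     subact S X act Y \<and> (\<exists>G. finite G \<and> G \<subseteq> X \<and> Y = subact S X act hull G)"

definition act_congruence ::
    "('a, 'm) monoid_scheme \<Rightarrow> 'x set \<Rightarrow> ('x \<Rightarrow> 'a \<Rightarrow> 'x) \<Rightarrow> ('x \<times> 'x) set \<Rightarrow> bool" where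
  "act_congruence S X act r \<longleftrightarrow>
     equiv X r \<and> (\<forall>(x, y)\<in>r. \<forall>s\<in>carrier S. (act x s, act y s) \<in> r)"

definition fg_act_congruence ::
    "('a, 'm) monoid_scheme \<Rightarrow> 'x set \<Rightarrow> ('x \<Rightarrow> 'a \<Rightarrow> 'x) \<Rightarrow> ('x \<times> 'x) set \<Rightarrow> bool" where
  "fg_act_congruence S X act r \<longleftrightarrow>
     act_congruence S X act r \<and>
     (\<exists>H. finite H \<and> H \<subseteq> X \<times> X \<and> r = act_congruence S X act hull H)"

text \<open>The action on the classes \<open>X // r\<close>; the union collapses to the single class of \<open>act x s\<close>
  when \<open>r\<close> is a congruence.\<close>

definition quot_act ::
    "('x \<Rightarrow> 'a \<Rightarrow> 'x) \<Rightarrow> ('x \<times> 'x) set \<Rightarrow> 'x set \<Rightarrow> 'a \<Rightarrow> 'x set" where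
  "quot_act act r C s = (\<Union>x\<in>C. r `` {act x s})"

text \<open>The free right act on a set \<open>I\<close> is \<open>I \<times> carrier S\<close> with \<open>i\<close> identified with \<open>(i, \<one>)\<close>.\<close>

definition free_act :: "('a, 'm) monoid_scheme \<Rightarrow> 'i \<times> 'a \<Rightarrow> 'a \<Rightarrow> 'i \<times> 'a" where
  "free_act S p s = (fst p, snd p \<otimes>\<^bsub>S\<^esub> s)"

text \<open>Up to isomorphism the finite set of free generators may be taken inside \<open>nat\<close>.\<close>

definition finitely_presented_act ::
    "('a, 'm) monoid_scheme \<Rightarrow> 'x set \<Rightarrow> ('x \<Rightarrow> 'a \<Rightarrow> 'x) \<Rightarrow> bool" where
  "finitely_presented_act S X act \<longleftrightarrow>
     right_act S X act \<and>
     (\<exists>(I :: nat set) r.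
        finite I \<and>
        fg_act_congruence S (I \<times> carrier S) (free_act S) r \<and>
        act_iso S X act ((I \<times> carrier S) // r) (quot_act (free_act S) r))"

text \<open>A definition in HOL cannot quantify over the types of all acts. Every finitely presented
  act is isomorphic to one whose elements are sets of pairs in \<open>nat \<times> 'a\<close>, so it suffices to
  quantify over acts on that type; \<open>right_coherentD\<close> below confirms that the property
  then holds for acts on every type.\<close>

definition right_coherent :: "('a, 'm) monoid_scheme \<Rightarrow> bool" where
  "right_coherent S \<longleftrightarrow>
     (\<forall>(X :: (nat \<times> 'a) set set) act Y.
        finitely_presented_act S X act \<longrightarrow> fg_subact S X act Y \<longrightarrow>
        finitely_presented_act S Y act)"


subsection \<open>Independence of the type of the act\<close>

lemma right_act_iso_transfer:
  assumes "right_act S X act" and f: "bij_betw f X Y"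
    and hom: "\<forall>x\<in>X. \<forall>s\<in>carrier S. f (act x s) = act' (f x) s"
  shows "right_act S Y act'"
proof -
  interpret right_act S X act by fact
  have Y: "Y = f ` X" using f by (simp add: bij_betw_def)
  show ?thesis
  proof unfold_locales
    fix y s assume "y \<in> Y" "s \<in> carrier S"
    then obtain x where x: "x \<in> X" "y = f x" "s \<in> carrier S" unfolding Y by blast
    then have "act' y s = f (act x s)" using hom by simp
    then show "act' y s \<in> Y" using x act_closed unfolding Y by simp
  next
    fix y assume "y \<in> Y"
    then obtain x where x: "x \<in> X" "y = f x" unfolding Y by blast
    then have "act' y \<one>\<^bsub>S\<^esub> = f (act x \<one>\<^bsub>S\<^esub>)" using hom by simp
    then show "act' y \<one>\<^bsub>S\<^esub> = y" using x act_one by simp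
  next
    fix y s t assume y: "y \<in> Y" and s: "s \<in> carrier S" and t: "t \<in> carrier S"
    then obtain x where x: "x \<in> X" "y = f x" unfolding Y by blast
    have "act' (act' y s) t = f (act (act x s) t)" using hom x s t act_closed by simp
    also have "\<dots> = act' y (s \<otimes>\<^bsub>S\<^esub> t)" using hom x s t act_assoc by simp
    finally show "act' (act' y s) t = act' y (s \<otimes>\<^bsub>S\<^esub> t)" .
  qed
qed

lemma act_iso_trans:
  assumes "bij_betw f X Y" "\<forall>x\<in>X. \<forall>s\<in>carrier S. f (act x s) = act' (f x) s"
    and "act_iso S Y act' Z act''"
  shows "act_iso S X act Z act''"
proof -
  obtain g where g: "bij_betw g Y Z" "\<forall>y\<in>Y. \<forall>s\<in>carrier S. g (act' y s) = act'' (g y) s"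
    using assms(3) unfolding act_iso_def by blast
  have "bij_betw (g \<circ> f) X Z" using assms(1) g(1) by (rule bij_betw_trans)
  moreover have "\<forall>x\<in>X. \<forall>s\<in>carrier S. (g \<circ> f) (act x s) = act'' ((g \<circ> f) x) s"
    using assms(1,2) g(2) by (simp add: bij_betw_apply)
  ultimately show ?thesis unfolding act_iso_def by blast
qed

lemma subact_image:
  assumes f: "bij_betw f X Y"
    and hom: "\<forall>x\<in>X. \<forall>s\<in>carrier S. f (act x s) = act' (f x) s"
    and Z: "subact S X act Z"
  shows "subact S Y act' (f ` Z)"
  unfolding subact_def
proof (intro conjI ballI)
  show "f ` Z \<subseteq> Y" using f Z by (auto simp: subact_def bij_betw_def)
  fix y s assume "y \<in> f ` Z" and s: "s \<in> carrier S"
  then obtain z where z: "z \<in> Z" "y = f z" by blast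
  then have "z \<in> X" "act z s \<in> Z" using Z s by (auto simp: subact_def)
  then show "act' y s \<in> f ` Z" using hom z s by (metis image_eqI)
qed

lemma fg_subact_image:
  assumes act: "right_act S X act" and f: "bij_betw f X Y"
    and hom: "\<forall>x\<in>X. \<forall>s\<in>carrier S. f (act x s) = act' (f x) s"
    and Z: "fg_subact S X act Z"
  shows "fg_subact S Y act' (f ` Z)"
proof -
  interpret right_act S X act by fact
  obtain G where G: "finite G" "G \<subseteq> X" and ZG: "Z = subact S X act hull G"
    and subZ: "subact S X act Z"
    using Z unfolding fg_subact_def by blast
  have inj: "inj_on f X" and Y: "Y = f ` X" using f by (auto simp: bij_betw_def)
  define g where "g = the_inv_into X f"
  have gf: "g (f x) = x" if "x \<in> X" for x
    using that inj by (simp add: g_def the_inv_into_f_f)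
  have g: "bij_betw g Y X" using f unfolding g_def by (rule bij_betw_the_inv_into)
  have ghom: "\<forall>y\<in>Y. \<forall>s\<in>carrier S. g (act' y s) = act (g y) s"
  proof (intro ballI)
    fix y s assume "y \<in> Y" and s: "s \<in> carrier S"
    then obtain x where x: "x \<in> X" "y = f x" unfolding Y by blast
    then have "g (act' y s) = g (f (act x s))" using hom s by simp
    then show "g (act' y s) = act (g y) s" using x s gf act_closed by simp
  qed
  have "f ` Z = subact S Y act' hull (f ` G)"
  proof (rule hull_unique[symmetric])
    show "f ` G \<subseteq> f ` Z" unfolding ZG using hull_subset[of G "subact S X act"] by (rule image_mono)
    show "subact S Y act' (f ` Z)" using f hom subZ by (rule subact_image)
    fix T assume GT: "f ` G \<subseteq> T" and T: "subact S Y act' T"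
    have "subact S X act (g ` T)" using g ghom T by (rule subact_image)
    moreover have "G \<subseteq> g ` T"
    proof
      fix x assume "x \<in> G"
      then have "f x \<in> T" "g (f x) = x" using GT G(2) gf by auto
      then show "x \<in> g ` T" by (metis imageI)
    qed
    ultimately have ZT: "Z \<subseteq> g ` T"
      unfolding ZG using hull_minimal[of G "g ` T" "subact S X act"] by simp
    have fg: "f (g y) = y" if "y \<in> T" for y
    proof -
      have "y \<in> Y" using T that unfolding subact_def by (auto dest: subsetD)
      then obtain x where "x \<in> X" "y = f x" unfolding Y by (rule imageE)
      then show ?thesis using gf by simp
    qed
    show "f ` Z \<subseteq> T"
    proof
      fix v assume "v \<in> f ` Z"
      then obtain y where "y \<in> T" "v = f (g y)" using ZT by blast
      then show "v \<in> T" using fg by simp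
    qed
  qed
  moreover have "finite (f ` G)" "f ` G \<subseteq> Y" using G unfolding Y by auto
  ultimately show ?thesis
    unfolding fg_subact_def using subact_image[OF f hom subZ] by blast
qed

lemma right_coherentD:
  fixes S :: "('a, 'm) monoid_scheme" and X :: "'x set" and act :: "'x \<Rightarrow> 'a \<Rightarrow> 'x"
  assumes coh: "right_coherent S"
    and fp: "finitely_presented_act S X act" and Y: "fg_subact S X act Y"
  shows "finitely_presented_act S Y act"
proof -
  have act: "right_act S X act" using fp by (simp add: finitely_presented_act_def)
  obtain I :: "nat set" and r where I: "finite I"
      "fg_act_congruence S (I \<times> carrier S) (free_act S) r"
    and iso: "act_iso S X act ((I \<times> carrier S) // r) (quot_act (free_act S) r)"
    using fp unfolding finitely_presented_act_def by blast
  let ?Q = "(I \<times> carrier S) // r" and ?q = "quot_act (free_act S) r"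
  obtain f where f: "bij_betw f X ?Q"
    and hom: "\<forall>x\<in>X. \<forall>s\<in>carrier S. f (act x s) = ?q (f x) s"
    using iso unfolding act_iso_def by blast
  have "act_iso S ?Q ?q ?Q ?q" unfolding act_iso_def by (rule exI[of _ id]) simp
  then have "finitely_presented_act S ?Q ?q"
    unfolding finitely_presented_act_def using right_act_iso_transfer[OF act f hom] I by blast
  moreover have "fg_subact S ?Q ?q (f ` Y)" using act f hom Y by (rule fg_subact_image)
  ultimately have fpY: "finitely_presented_act S (f ` Y) ?q"
    using coh unfolding right_coherent_def by blast
  have YX: "subact S X act Y" using Y by (simp add: fg_subact_def)
  then have "Y \<subseteq> X" by (simp add: subact_def)
  then have fY: "bij_betw f Y (f ` Y)" and homY: "\<forall>x\<in>Y. \<forall>s\<in>carrier S. f (act x s) = ?q (f x) s"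
    using f hom by (auto simp: bij_betw_def intro: inj_on_subset)
  have "right_act S Y act"
    using act YX \<open>Y \<subseteq> X\<close>
    by (auto simp: right_act_def right_act_axioms_def subact_def subset_iff)
  then show ?thesis
    using fpY act_iso_trans[OF fY homY] unfolding finitely_presented_act_def by blast
qed

end

theory Submission
  imports Defs
begin

text \<open>
  Coherency fails because of a single annihilator. If \<open>M\<close> is right coherent, then every element
  \<open>x\<close> of a finitely presented right act generates a finitely presented subact \<open>x M\<close>. Since
  \<open>x M\<close> is isomorphic to the quotient of \<open>M\<close> by the right congruence \<open>{(s, t). x s = x t}\<close>, the
  annihilator of \<open>x\<close>, this right congruence is finitely generated
  (\<open>finitely_generated_annihilator\<close>; the passage between two presentations of the same act is
  \<open>cyclic_finitely_presented_annihilator\<close>).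

  Let \<open>1\<close> be the identity of \<open>M\<close>, and apply this to the quotient of \<open>M\<close> by the right congruence
  generated by the single pair \<open>(1, a)\<close>. It relates \<open>x\<close> and \<open>y\<close> when \<open>a\<^sup>i x = a\<^sup>j y\<close> for some
  \<open>i, j\<close>, so the annihilator of the class of \<open>b\<close> consists of the pairs \<open>(s, t)\<close> with
  \<open>a\<^sup>i b s = a\<^sup>j b t\<close> for some \<open>i, j\<close>. A finite set of such pairs involves only exponents up
  to some \<open>n\<close>. Consider the property \<open>a\<^sup>n b c = a\<^sup>n b\<close> of \<open>c\<close>. Rewriting \<open>t x\<close> to \<open>s x\<close> along one of
  the finitely many pairs preserves it: \<open>a\<^sup>n b t x = a\<^sup>n b\<close> gives \<open>a\<^sup>n b = a\<^sup>m b s x\<close> for some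
  \<open>m\<close>, and then \<open>a\<^sup>n b\<close> lies below \<open>a\<^sup>m b\<close> in the preorder, which by incomparability forces
  \<open>m = n\<close>. The identity has the property, so every element related to it by the right
  congruence that these pairs generate has the property too. But an element of \<open>M \<inter> E\<close> which
  fixes \<open>a\<^sup>n\<^sup>+\<^sup>1 b\<close> on the right and does not fix \<open>a\<^sup>n b\<close> is related to the identity by the
  annihilator and does not have the property. Hence no finite set generates the annihilator. This
  argument is \<open>not_right_coherent_if_powers\<close>, which speaks of \<open>M\<close> alone;
  \<open>Rtilde_le_mult_right\<close> translates incomparability in \<open>F\<close> to it.
\<close>

section \<open>Quotients of acts and annihilators\<close>

lemma quot_act_class:
  assumes "right_act S X act" and r: "act_congruence S X act r"
    and x: "x \<in> X" and s: "s \<in> carrier S"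
  shows "quot_act act r (r `` {x}) s = r `` {act x s}"
proof -
  have eq: "equiv X r"
    and cong: "\<And>y z. (y, z) \<in> r \<Longrightarrow> (act y s, act z s) \<in> r"
    using r s unfolding act_congruence_def by auto
  have "r `` {act y s} = r `` {act x s}" if "y \<in> r `` {x}" for y
    using that cong equiv_class_eq[OF eq] by blast
  moreover have "x \<in> r `` {x}" using eq x by (rule equiv_class_self)
  ultimately show ?thesis unfolding quot_act_def by blast
qed

lemma right_act_quotient:
  assumes act: "right_act S X act" and r: "act_congruence S X act r"
  shows "right_act S (X // r) (quot_act act r)"
proof -
  interpret right_act S X act by fact
  note on_class = quot_act_class[OF act r]
  show ?thesis
    by unfold_locales
      (auto elim!: quotientE simp: on_class act_closed act_one act_assoc intro!: quotientI)
qed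

lemma right_act_free:
  assumes "monoid S"
  shows "right_act S (I \<times> carrier S) (free_act S)"
proof -
  interpret monoid S by fact
  show ?thesis by unfold_locales (auto simp: free_act_def m_assoc)
qed

lemma finitely_presented_quotient:
  fixes I :: "nat set"
  assumes S: "monoid S" and I: "finite I"
    and r: "fg_act_congruence S (I \<times> carrier S) (free_act S) r"
  shows "finitely_presented_act S ((I \<times> carrier S) // r) (quot_act (free_act S) r)"
proof -
  have "act_congruence S (I \<times> carrier S) (free_act S) r"
    using r by (simp add: fg_act_congruence_def)
  then have "right_act S ((I \<times> carrier S) // r) (quot_act (free_act S) r)"
    using right_act_free[OF S] right_act_quotient by blast
  moreover have "act_iso S Q q Q q" for Q :: "(nat \<times> 'a) set set" and q
    unfolding act_iso_def by (rule exI[of _ id]) simp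
  ultimately show ?thesis unfolding finitely_presented_act_def using I r by blast
qed

definition annihilator ::
    "('a, 'm) monoid_scheme \<Rightarrow> ('x \<Rightarrow> 'a \<Rightarrow> 'x) \<Rightarrow> 'x \<Rightarrow> ('a \<times> 'a) set" where
  "annihilator S act x = {(s, t) \<in> carrier S \<times> carrier S. act x s = act x t}"

lemma (in right_act) act_congruence_annihilator:
  assumes x: "x \<in> X"
  shows "act_congruence S (carrier S) (mult S) (annihilator S act x)"
  unfolding act_congruence_def
proof (intro conjI)
  show "equiv (carrier S) (annihilator S act x)"
    by (rule equivI) (auto simp: annihilator_def refl_on_def sym_def trans_def)
  show "\<forall>(s, t)\<in>annihilator S act x. \<forall>v\<in>carrier S.
      (s \<otimes> v, t \<otimes> v) \<in> annihilator S act x"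
    using x by (auto simp: annihilator_def simp flip: act_assoc)
qed

lemma (in right_act) hull_singleton:
  assumes x: "x \<in> X"
  shows "subact S X act hull {x} = act x ` carrier S"
proof (rule hull_unique)
  show "{x} \<subseteq> act x ` carrier S" using act_one[OF x] by force
  show "subact S X act (act x ` carrier S)"
    using x by (auto simp: subact_def act_closed act_assoc)
  show "act x ` carrier S \<subseteq> T" if "{x} \<subseteq> T" "subact S X act T" for T
    using that by (auto simp: subact_def)
qed

lemma (in right_act) fg_subact_cyclic:
  assumes x: "x \<in> X"
  shows "fg_subact S X act (act x ` carrier S)"
  unfolding fg_subact_def
proof
  show "subact S X act (act x ` carrier S)"
    using x by (auto simp: subact_def act_closed act_assoc)
  show "\<exists>G. finite G \<and> G \<subseteq> X \<and> act x ` carrier S = subact S X act hull G"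
    using x hull_singleton[OF x] by (intro exI[of _ "{x}"]) auto
qed

text \<open>
  Finite generation of the relations of a cyclic act does not depend on the presentation. Let
  \<open>f\<close> be an isomorphism from \<open>x S\<close> to \<open>(J \<times> S) // \<sigma>\<close>, let \<open>p0\<close> represent the image of \<open>x\<close>,
  and write the class of each free generator \<open>j\<close> as the image of \<open>x g\<^sub>j\<close>. The equivariant map
  \<open>\<phi> (j, m) = g\<^sub>j m\<close> from \<open>J \<times> S\<close> to \<open>S\<close> turns the finitely many pairs which generate
  \<open>\<sigma>\<close> into pairs in the annihilator of \<open>x\<close>. Together with the pair \<open>(\<phi> p0, 1)\<close> these generate it.
\<close>
lemma cyclic_finitely_presented_annihilator:
  fixes S :: "('a, 'm) monoid_scheme" (structure)
  assumes fp: "finitely_presented_act S Y act" and x: "x \<in> Y"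
    and Y: "Y = act x ` carrier S"
  shows "fg_act_congruence S (carrier S) (mult S) (annihilator S act x)"
proof -
  interpret right_act S Y act using fp by (simp add: finitely_presented_act_def)
  let ?A = "annihilator S act x"
  obtain J :: "nat set" and \<sigma> f where J: "finite J"
    and \<sigma>: "fg_act_congruence S (J \<times> carrier S) (free_act S) \<sigma>"
    and bij: "bij_betw f Y ((J \<times> carrier S) // \<sigma>)"
    and hom: "\<And>y s. y \<in> Y \<Longrightarrow> s \<in> carrier S \<Longrightarrow>
        f (act y s) = quot_act (free_act S) \<sigma> (f y) s"
    using fp unfolding finitely_presented_act_def act_iso_def by blast
  let ?P = "J \<times> carrier S"
  have cong: "act_congruence S ?P (free_act S) \<sigma>" using \<sigma> by (simp add: fg_act_congruence_def)
  then have eq: "equiv ?P \<sigma>" by (simp add: act_congruence_def)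
  obtain H where H: "finite H" and \<sigma>H: "\<sigma> = act_congruence S ?P (free_act S) hull H"
    using \<sigma> unfolding fg_act_congruence_def by blast
  have H\<sigma>: "H \<subseteq> \<sigma>" unfolding \<sigma>H by (rule hull_subset)
  have free: "right_act S ?P (free_act S)" using monoid_axioms by (rule right_act_free)
  note on_class = quot_act_class[OF free cong]
  have P_act: "free_act S p s \<in> ?P" if "p \<in> ?P" "s \<in> carrier S" for p s
    using that by (auto simp: free_act_def)
  have inj: "inj_on f Y" and fY: "f ` Y = ?P // \<sigma>" using bij by (auto simp: bij_betw_def)
  have "f x \<in> ?P // \<sigma>" using x fY by blast
  then obtain p0 where p0: "p0 \<in> ?P" and fx: "f x = \<sigma> `` {p0}" by (auto elim: quotientE)
  have fx_act: "f (act x s) = \<sigma> `` {free_act S p0 s}" if "s \<in> carrier S" for s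
    using hom[OF x that] on_class[OF p0 that] fx by simp
  have "\<exists>g\<in>carrier S. f (act x g) = \<sigma> `` {(j, \<one>)}" if "j \<in> J" for j
  proof -
    have "\<sigma> `` {(j, \<one>)} \<in> f ` act x ` carrier S"
      using that fY Y by (auto intro!: quotientI)
    then show ?thesis by force
  qed
  then obtain g where g: "\<And>j. j \<in> J \<Longrightarrow> g j \<in> carrier S"
    and fg: "\<And>j. j \<in> J \<Longrightarrow> f (act x (g j)) = \<sigma> `` {(j, \<one>)}"
    by metis
  define \<phi> where "\<phi> p = g (fst p) \<otimes> snd p" for p
  have \<phi>_closed: "\<phi> p \<in> carrier S" if "p \<in> ?P" for p
    using that g by (auto simp: \<phi>_def)
  have \<phi>_act: "\<phi> (free_act S p s) = \<phi> p \<otimes> s" if "p \<in> ?P" "s \<in> carrier S" for p s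
    using that g by (auto simp: \<phi>_def free_act_def m_assoc)
  have f\<phi>: "f (act x (\<phi> p)) = \<sigma> `` {p}" if p: "p \<in> ?P" for p
  proof -
    obtain j m where jm: "p = (j, m)" "j \<in> J" "m \<in> carrier S" using p by auto
    have "f (act x (\<phi> p)) = f (act (act x (g j)) m)"
      using jm g x by (simp add: \<phi>_def act_assoc)
    also have "\<dots> = quot_act (free_act S) \<sigma> (\<sigma> `` {(j, \<one>)}) m"
      unfolding fg[OF jm(2), symmetric] using jm g x by (intro hom act_closed)
    also have "\<dots> = \<sigma> `` {p}" using jm by (simp add: on_class free_act_def)
    finally show ?thesis .
  qed
  have \<phi>_ann: "(\<phi> p, \<phi> q) \<in> ?A" if "(p, q) \<in> \<sigma>" for p q
  proof -
    have pq: "p \<in> ?P" "q \<in> ?P" "\<sigma> `` {p} = \<sigma> `` {q}"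
      using that equiv_class_eq_iff[OF eq] by blast+
    then have "f (act x (\<phi> p)) = f (act x (\<phi> q))" by (simp add: f\<phi>)
    then have "act x (\<phi> p) = act x (\<phi> q)"
      using inj pq x \<phi>_closed act_closed by (simp add: inj_on_eq_iff)
    then show ?thesis using pq \<phi>_closed by (simp add: annihilator_def)
  qed
  have \<phi>p0: "(\<phi> p0, \<one>) \<in> ?A"
  proof -
    have "f (act x (\<phi> p0)) = f x" using p0 fx by (simp add: f\<phi>)
    then have "act x (\<phi> p0) = x" using inj p0 x \<phi>_closed act_closed by (simp add: inj_on_eq_iff)
    then show ?thesis using p0 \<phi>_closed x act_one by (simp add: annihilator_def)
  qed
  define K where "K = insert (\<phi> p0, \<one>) ((\<lambda>(p, q). (\<phi> p, \<phi> q)) ` H)"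
  have KA: "K \<subseteq> ?A" using \<phi>p0 \<phi>_ann H\<sigma> by (auto simp: K_def)
  have "act_congruence S (carrier S) (mult S) hull K = ?A"
  proof (rule hull_unique)
    show "act_congruence S (carrier S) (mult S) ?A" using x by (rule act_congruence_annihilator)
  next
    fix T assume KT: "K \<subseteq> T" and T: "act_congruence S (carrier S) (mult S) T"
    have eqT: "equiv (carrier S) T"
      and congT: "\<And>s t v. (s, t) \<in> T \<Longrightarrow> v \<in> carrier S \<Longrightarrow> (s \<otimes> v, t \<otimes> v) \<in> T"
      using T unfolding act_congruence_def by auto
    have symT: "sym T" and transT: "trans T" using eqT by (auto elim: equivE)
    \<comment> \<open>The preimage of \<open>T\<close> under \<open>\<phi>\<close> is a congruence containing \<open>H\<close>, hence contains \<open>\<sigma>\<close>.\<close>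
    define R where "R = {(p, q) \<in> ?P \<times> ?P. (\<phi> p, \<phi> q) \<in> T}"
    have "act_congruence S ?P (free_act S) R"
      unfolding act_congruence_def
    proof (intro conjI)
      show "equiv ?P R"
      proof (rule equivI)
        show "refl_on ?P R" using eqT \<phi>_closed by (auto simp: R_def refl_on_def elim!: equivE)
        show "sym R" using symT by (auto simp: R_def sym_def)
        show "trans R" using transT by (auto simp: R_def intro!: transI dest: transD)
      qed (auto simp: R_def)
      show "\<forall>(p, q)\<in>R. \<forall>s\<in>carrier S. (free_act S p s, free_act S q s) \<in> R"
        using congT \<phi>_act P_act unfolding R_def by auto
    qed
    moreover have "H \<subseteq> R"
    proof
      fix h assume h: "h \<in> H"
      then have "h \<in> \<sigma>" using H\<sigma> by blast
      then have "h \<in> ?P \<times> ?P" using equiv_type[OF eq] by blast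
      moreover have "(\<phi> (fst h), \<phi> (snd h)) \<in> T" using h KT by (force simp: K_def)
      ultimately show "h \<in> R" by (auto simp: R_def)
    qed
    ultimately have \<sigma>R: "\<sigma> \<subseteq> R" unfolding \<sigma>H by (intro hull_minimal)
    show "?A \<subseteq> T"
    proof (rule subrelI)
      fix s t assume "(s, t) \<in> ?A"
      then have st: "s \<in> carrier S" "t \<in> carrier S" "act x s = act x t"
        by (auto simp: annihilator_def)
      have "\<sigma> `` {free_act S p0 s} = \<sigma> `` {free_act S p0 t}" using st fx_act by metis
      then have "(free_act S p0 s, free_act S p0 t) \<in> \<sigma>"
        using eq_equiv_class_iff[OF eq] P_act[OF p0] st by blast
      then have "(\<phi> (free_act S p0 s), \<phi> (free_act S p0 t)) \<in> T"
        using \<sigma>R by (auto simp: R_def)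
      then have mid: "(\<phi> p0 \<otimes> s, \<phi> p0 \<otimes> t) \<in> T"
        using st by (simp add: \<phi>_act[OF p0])
      have "(\<phi> p0, \<one>) \<in> T" using KT by (simp add: K_def)
      then have "(\<phi> p0 \<otimes> v, v) \<in> T" if "v \<in> carrier S" for v
        using congT[of "\<phi> p0" \<one> v] that by simp
      then show "(s, t) \<in> T" using mid st symT transT by (meson symD transD)
    qed
  qed (rule KA)
  moreover have "finite K" using H by (simp add: K_def)
  moreover have "K \<subseteq> carrier S \<times> carrier S" using KA by (auto simp: annihilator_def)
  ultimately show ?thesis
    unfolding fg_act_congruence_def using act_congruence_annihilator[OF x] by metis
qed

lemma finitely_generated_annihilator:
  assumes coh: "right_coherent S" and fp: "finitely_presented_act S X act" and x: "x \<in> X"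
  shows "fg_act_congruence S (carrier S) (mult S) (annihilator S act x)"
proof (rule cyclic_finitely_presented_annihilator)
  interpret right_act S X act using fp by (simp add: finitely_presented_act_def)
  show "finitely_presented_act S (act x ` carrier S) act"
    using right_coherentD[OF coh fp fg_subact_cyclic[OF x]] .
  show "x \<in> act x ` carrier S" using act_one[OF x] by force
qed (rule refl)


section \<open>The right congruence generated by identifying \<open>a\<close> with the identity\<close>

text \<open>The index \<open>0\<close> is the single generator of the free right act of rank one, which is where
  a presentation of the quotient has to live.\<close>
definition power_congruence :: "('a, 'm) monoid_scheme \<Rightarrow> 'a \<Rightarrow> ((nat \<times> 'a) \<times> (nat \<times> 'a)) set" where
  "power_congruence S a =
     {((k, x), (l, y)). k = 0 \<and> l = 0 \<and> x \<in> carrier S \<and> y \<in> carrier S \<and>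
        (\<exists>(i::nat) (j::nat). a [^]\<^bsub>S\<^esub> i \<otimes>\<^bsub>S\<^esub> x = a [^]\<^bsub>S\<^esub> j \<otimes>\<^bsub>S\<^esub> y)}"

lemma (in monoid) pow_add_mult:
  assumes "a \<in> carrier G" "x \<in> carrier G"
  shows "a [^] (m + n :: nat) \<otimes> x = a [^] m \<otimes> (a [^] n \<otimes> x)"
  using assms by (simp add: m_assoc flip: nat_pow_mult)

text \<open>
  Transitivity holds since powers of \<open>a\<close> commute: \<open>a\<^sup>i x = a\<^sup>j y\<close> and \<open>a\<^sup>k y = a\<^sup>l z\<close> give
  \<open>a\<^sup>k\<^sup>+\<^sup>i x = a\<^sup>j\<^sup>+\<^sup>l z\<close>. A congruence containing the generating pair relates every \<open>x\<close> to
  \<open>a x\<close>, hence to every \<open>a\<^sup>i x\<close>.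
\<close>
lemma fg_power_congruence:
  fixes S :: "('a, 'm) monoid_scheme" (structure)
  assumes "monoid S" and a: "a \<in> carrier S"
  shows "fg_act_congruence S ({0} \<times> carrier S) (free_act S) (power_congruence S a)"
proof -
  interpret monoid S by fact
  let ?P = "{0 :: nat} \<times> carrier S" and ?\<rho> = "power_congruence S a"
  let ?H = "{((0 :: nat, \<one>), (0 :: nat, a))}"
  have cong: "act_congruence S ?P (free_act S) ?\<rho>"
    unfolding act_congruence_def
  proof (intro conjI)
    show "equiv ?P ?\<rho>"
    proof (rule equivI)
      show "refl_on ?P ?\<rho>" by (auto simp: refl_on_def power_congruence_def)
      show "sym ?\<rho>" unfolding sym_def power_congruence_def by auto metis
      show "trans ?\<rho>"
      proof (rule transI)
        fix p q r assume pq: "(p, q) \<in> ?\<rho>" and qr: "(q, r) \<in> ?\<rho>"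
        then obtain x y z where xyz: "p = (0, x)" "q = (0, y)" "r = (0, z)"
            "x \<in> carrier S" "y \<in> carrier S" "z \<in> carrier S"
          by (auto simp: power_congruence_def)
        obtain i j where ij: "a [^] (i::nat) \<otimes> x = a [^] (j::nat) \<otimes> y"
          using pq xyz by (auto simp: power_congruence_def)
        obtain k l where kl: "a [^] (k::nat) \<otimes> y = a [^] (l::nat) \<otimes> z"
          using qr xyz by (auto simp: power_congruence_def)
        have "a [^] (k + i) \<otimes> x = a [^] (k + j) \<otimes> y"
          using a xyz by (simp add: pow_add_mult ij)
        also have "\<dots> = a [^] (j + k) \<otimes> y" by (simp add: add.commute)
        also have "\<dots> = a [^] (j + l) \<otimes> z" using a xyz by (simp add: pow_add_mult kl)
        finally show "(p, r) \<in> ?\<rho>" using xyz unfolding power_congruence_def by blast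
      qed
    qed (auto simp: power_congruence_def)
    have "(free_act S p s, free_act S q s) \<in> ?\<rho>" if pq: "(p, q) \<in> ?\<rho>" and s: "s \<in> carrier S" for p q s
    proof -
      obtain x y i j where xy: "p = (0, x)" "q = (0, y)" "x \<in> carrier S" "y \<in> carrier S"
          and "a [^] (i::nat) \<otimes> x = a [^] (j::nat) \<otimes> y"
        using pq by (auto simp: power_congruence_def)
      then have "a [^] i \<otimes> (x \<otimes> s) = a [^] j \<otimes> (y \<otimes> s)" using a s by (simp flip: m_assoc)
      then show ?thesis using xy s unfolding power_congruence_def free_act_def by auto
    qed
    then show "\<forall>(p, q)\<in>?\<rho>. \<forall>s\<in>carrier S. (free_act S p s, free_act S q s) \<in> ?\<rho>" by blast
  qed
  have "act_congruence S ?P (free_act S) hull ?H = ?\<rho>"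
  proof (rule hull_unique)
    have "a [^] Suc 0 \<otimes> \<one> = a [^] (0::nat) \<otimes> a" using a by simp
    then show "?H \<subseteq> ?\<rho>" using a unfolding power_congruence_def by blast
  next
    fix T assume HT: "?H \<subseteq> T" and T: "act_congruence S ?P (free_act S) T"
    have eqT: "equiv ?P T"
      and congT: "\<And>p q s. (p, q) \<in> T \<Longrightarrow> s \<in> carrier S \<Longrightarrow> (free_act S p s, free_act S q s) \<in> T"
      using T unfolding act_congruence_def by auto
    have reflT: "refl_on ?P T" and symT: "sym T" and transT: "trans T"
      using eqT by (auto elim: equivE)
    have step: "((0, x), (0, a \<otimes> x)) \<in> T" if "x \<in> carrier S" for x
      using congT[of "(0, \<one>)" "(0, a)" x] HT that by (simp add: free_act_def)
    have pow: "((0, x), (0, a [^] (i::nat) \<otimes> x)) \<in> T" if x: "x \<in> carrier S" for x i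
    proof (induction i)
      case 0
      show ?case using x reflT by (simp add: refl_on_def)
    next
      case (Suc i)
      have "a [^] Suc i \<otimes> x = a \<otimes> (a [^] i \<otimes> x)"
        using pow_add_mult[OF a x, of 1 i] a by simp
      then show ?case using Suc.IH step[of "a [^] i \<otimes> x"] a x transT by (auto dest: transD)
    qed
    show "?\<rho> \<subseteq> T"
    proof (rule subrelI)
      fix p q assume "(p, q) \<in> ?\<rho>"
      then obtain x y i j where "p = (0, x)" "q = (0, y)" "x \<in> carrier S" "y \<in> carrier S"
          and "a [^] (i::nat) \<otimes> x = a [^] (j::nat) \<otimes> y"
        by (auto simp: power_congruence_def)
      then show "(p, q) \<in> T" using pow[of x i] pow[of y j] symT transT by (metis symD transD)
    qed
  qed (rule cong)
  moreover have "finite ?H" "?H \<subseteq> ?P \<times> ?P" using a by auto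
  ultimately show ?thesis unfolding fg_act_congruence_def using cong by metis
qed

lemma annihilator_power_quotient:
  fixes S :: "('a, 'm) monoid_scheme" (structure)
  assumes "monoid S" and a: "a \<in> carrier S" and b: "b \<in> carrier S"
  shows "annihilator S (quot_act (free_act S) (power_congruence S a))
           (power_congruence S a `` {(0, b)}) =
         {(s, t) \<in> carrier S \<times> carrier S.
            \<exists>(i::nat) (j::nat). a [^] i \<otimes> b \<otimes> s = a [^] j \<otimes> b \<otimes> t}"
proof -
  interpret monoid S by fact
  let ?P = "{0 :: nat} \<times> carrier S" and ?\<rho> = "power_congruence S a"
  have cong: "act_congruence S ?P (free_act S) ?\<rho>"
    using fg_power_congruence[OF assms(1) a] by (simp add: fg_act_congruence_def)
  then have eq: "equiv ?P ?\<rho>" by (simp add: act_congruence_def)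
  have orbit: "quot_act (free_act S) ?\<rho> (?\<rho> `` {(0, b)}) s = ?\<rho> `` {(0, b \<otimes> s)}"
    if "s \<in> carrier S" for s
    using quot_act_class[OF right_act_free[OF assms(1)] cong, of "(0, b)" s] b that
    by (simp add: free_act_def)
  have same_class: "?\<rho> `` {(0, b \<otimes> s)} = ?\<rho> `` {(0, b \<otimes> t)} \<longleftrightarrow>
      (\<exists>(i::nat) (j::nat). a [^] i \<otimes> b \<otimes> s = a [^] j \<otimes> b \<otimes> t)"
    if "s \<in> carrier S" "t \<in> carrier S" for s t
    using that a b eq_equiv_class_iff[OF eq, of "(0, b \<otimes> s)" "(0, b \<otimes> t)"]
    by (simp add: power_congruence_def m_assoc)
  show ?thesis unfolding annihilator_def
    by (intro Collect_cong) (simp add: case_prod_beta orbit same_class cong: conj_cong)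
qed


section \<open>An annihilator that is not finitely generated\<close>

text \<open>
  The syntactic right congruence of the set \<open>{c. z c = z}\<close>, that is, the largest right congruence
  of which this set is a union of classes. A finitely generated right congruence is below it as soon
  as its generating pairs are, so no chains of rewriting steps have to be followed.
\<close>
definition fixing_congruence :: "('a, 'm) monoid_scheme \<Rightarrow> 'a \<Rightarrow> ('a \<times> 'a) set" where
  "fixing_congruence S z = {(s, t) \<in> carrier S \<times> carrier S.
     \<forall>x\<in>carrier S. z \<otimes>\<^bsub>S\<^esub> (s \<otimes>\<^bsub>S\<^esub> x) = z \<longleftrightarrow> z \<otimes>\<^bsub>S\<^esub> (t \<otimes>\<^bsub>S\<^esub> x) = z}"

lemma (in monoid) act_congruence_fixing:
  "act_congruence G (carrier G) (mult G) (fixing_congruence G z)"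
  unfolding act_congruence_def
proof (intro conjI)
  show "equiv (carrier G) (fixing_congruence G z)"
    by (rule equivI) (auto simp: fixing_congruence_def refl_on_def sym_def trans_def)
  show "\<forall>(s, t)\<in>fixing_congruence G z. \<forall>v\<in>carrier G.
      (s \<otimes> v, t \<otimes> v) \<in> fixing_congruence G z"
    by (auto simp: fixing_congruence_def m_assoc)
qed

text \<open>
  The obstruction in terms of a single monoid. The first hypothesis on \<open>a\<close> and \<open>b\<close> is what
  incomparability provides here: for \<open>m \<noteq> n\<close> the principal right ideals of \<open>a\<^sup>m b\<close> and
  \<open>a\<^sup>n b\<close> do not contain each other. As everything that fixes \<open>a\<^sup>n b\<close> on the right also fixes
  \<open>a\<^sup>n\<^sup>+\<^sup>1 b\<close>, the second hypothesis makes the right stabilisers grow strictly with \<open>n\<close>; the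
  elements that are new at stage \<open>n + 1\<close> are related to the identity by the annihilator, but not
  through pairs whose exponents are at most \<open>n\<close>.
\<close>
lemma not_right_coherent_if_powers:
  fixes S :: "('a, 'm) monoid_scheme" (structure)
  assumes S: "monoid S" and a: "a \<in> carrier S" and b: "b \<in> carrier S"
    and incomparable: "\<And>m n c. c \<in> carrier S \<Longrightarrow>
      a [^] (n::nat) \<otimes> b = a [^] (m::nat) \<otimes> b \<otimes> c \<Longrightarrow> m = n"
    and growing: "\<And>n::nat. \<exists>f\<in>carrier S.
      a [^] Suc n \<otimes> b \<otimes> f = a [^] Suc n \<otimes> b \<and>
      a [^] n \<otimes> b \<otimes> f \<noteq> a [^] n \<otimes> b"
  shows "\<not> right_coherent S"
proof
  assume coh: "right_coherent S"
  interpret monoid S by fact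
  let ?\<rho> = "power_congruence S a"
  define A where "A = {(s, t) \<in> carrier S \<times> carrier S.
    \<exists>(i::nat) (j::nat). a [^] i \<otimes> b \<otimes> s = a [^] j \<otimes> b \<otimes> t}"
  have "finitely_presented_act S (({0} \<times> carrier S) // ?\<rho>) (quot_act (free_act S) ?\<rho>)"
    using finitely_presented_quotient[OF S _ fg_power_congruence[OF S a]] by simp
  moreover have "?\<rho> `` {(0, b)} \<in> ({0} \<times> carrier S) // ?\<rho>" using b by (simp add: quotientI)
  ultimately have "fg_act_congruence S (carrier S) (mult S) A"
    unfolding A_def annihilator_power_quotient[OF S a b, symmetric]
    by (rule finitely_generated_annihilator[OF coh])
  then obtain H where H: "finite H" and AH: "A = act_congruence S (carrier S) (mult S) hull H"
    unfolding fg_act_congruence_def by blast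
  have HA: "H \<subseteq> A" unfolding AH by (rule hull_subset)
  then have "\<exists>(i::nat) (j::nat). a [^] i \<otimes> b \<otimes> fst h = a [^] j \<otimes> b \<otimes> snd h" if "h \<in> H" for h
    using that by (cases h) (auto simp: A_def)
  then obtain i j :: "_ \<Rightarrow> nat"
    where ij: "\<And>h. h \<in> H \<Longrightarrow> a [^] i h \<otimes> b \<otimes> fst h = a [^] j h \<otimes> b \<otimes> snd h"
    by metis
  have "finite ((\<lambda>h. i h + j h) ` H)" using H by simp
  then obtain n where n: "\<And>h. h \<in> H \<Longrightarrow> i h + j h \<le> n"
    unfolding finite_nat_set_iff_bounded_le by blast
  define z where "z = a [^] n \<otimes> b"
  have z: "z \<in> carrier S" using a b by (simp add: z_def)
  have transfer: "z \<otimes> (s \<otimes> x) = z"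
    if eq: "a [^] k \<otimes> b \<otimes> s = a [^] l \<otimes> b \<otimes> t" and "l \<le> n"
      and fixed: "z \<otimes> (t \<otimes> x) = z"
      and car: "s \<in> carrier S" "t \<in> carrier S" "x \<in> carrier S"
    for s t x and k l :: nat
  proof -
    \<comment> \<open>Multiply the given equation by \<open>a\<^sup>n\<^sup>-\<^sup>l\<close> to compare \<open>z t\<close> with an element of the form
      \<open>a\<^sup>m b s\<close>.\<close>
    define m where "m = (n - l) + k"
    have lift: "a [^] ((n - l) + p) \<otimes> b \<otimes> v = a [^] (n - l) \<otimes> (a [^] p \<otimes> b \<otimes> v)"
      if "v \<in> carrier S" for v and p :: nat
      using that a b by (simp add: pow_add_mult m_assoc)
    have "z \<otimes> t = a [^] ((n - l) + l) \<otimes> b \<otimes> t" using \<open>l \<le> n\<close> by (simp add: z_def)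
    also have "\<dots> = a [^] m \<otimes> b \<otimes> s"
      unfolding m_def lift[OF car(1)] lift[OF car(2)] eq ..
    finally have zt: "z \<otimes> t = a [^] m \<otimes> b \<otimes> s" .
    have "z = z \<otimes> t \<otimes> x" using fixed z car by (simp add: m_assoc)
    also have "\<dots> = a [^] m \<otimes> b \<otimes> (s \<otimes> x)" unfolding zt using a b car by (simp add: m_assoc)
    finally have eq': "z = a [^] m \<otimes> b \<otimes> (s \<otimes> x)" .
    then have "m = n" using incomparable[of "s \<otimes> x" n m] car unfolding z_def by simp
    then show ?thesis using eq' by (simp add: z_def)
  qed
  have "H \<subseteq> fixing_congruence S z"
  proof
    fix h assume h: "h \<in> H"
    then have car: "fst h \<in> carrier S" "snd h \<in> carrier S" using HA by (auto simp: A_def)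
    have "i h \<le> n" "j h \<le> n" using n[OF h] by auto
    then have "z \<otimes> (fst h \<otimes> x) = z \<longleftrightarrow> z \<otimes> (snd h \<otimes> x) = z" if "x \<in> carrier S" for x
      using transfer[OF ij[OF h]] transfer[OF ij[OF h, symmetric]] car that by blast
    then show "h \<in> fixing_congruence S z"
      using car by (cases h) (auto simp: fixing_congruence_def)
  qed
  then have A_fixing: "A \<subseteq> fixing_congruence S z"
    unfolding AH using act_congruence_fixing by (intro hull_minimal)
  obtain f where f: "f \<in> carrier S" and next_fixed: "a [^] Suc n \<otimes> b \<otimes> f = a [^] Suc n \<otimes> b"
    and not_fixed: "z \<otimes> f \<noteq> z"
    using growing[of n] unfolding z_def by blast
  have "a [^] Suc n \<otimes> b \<otimes> f = a [^] Suc n \<otimes> b \<otimes> \<one>" using next_fixed a b by simp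
  then have "(f, \<one>) \<in> A" using f unfolding A_def by blast
  then have "z \<otimes> (f \<otimes> \<one>) = z \<longleftrightarrow> z \<otimes> (\<one> \<otimes> \<one>) = z"
    using A_fixing unfolding fixing_congruence_def by blast
  then show False using not_fixed f z by simp
qed


section \<open>Monoid subsemigroups of left Ehresmann monoids\<close>

text \<open>Only the zeroth power depends on the choice of identity, and multiplying by an element of
  \<open>M\<close> removes the difference.\<close>
lemma submonoid_pow_mult:
  assumes "monoid F" and M: "monoid_subsemigroup F M u" and a: "a \<in> M" and "b \<in> M"
  shows "a [^]\<^bsub>submonoid_with_one F M u\<^esub> (i::nat) \<otimes>\<^bsub>F\<^esub> b = a [^]\<^bsub>F\<^esub> i \<otimes>\<^bsub>F\<^esub> b"
proof -
  let ?S = "submonoid_with_one F M u"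
  interpret F: monoid F by fact
  interpret S: monoid ?S using M by (simp add: monoid_subsemigroup_def)
  have S_simps: "carrier ?S = M" "mult ?S = mult F" by (simp_all add: submonoid_with_one_def)
  have MF: "M \<subseteq> carrier F" using M by (simp add: monoid_subsemigroup_def)
  show ?thesis using \<open>b \<in> M\<close>
  proof (induction i arbitrary: b)
    case 0
    then show ?case using S.l_one[of b] MF S_simps by auto
  next
    case (Suc i)
    have ab: "a \<otimes>\<^bsub>F\<^esub> b \<in> M" using S.m_closed[of a b] a Suc.prems S_simps by simp
    have "a [^]\<^bsub>?S\<^esub> Suc i \<otimes>\<^bsub>F\<^esub> b = a [^]\<^bsub>?S\<^esub> i \<otimes>\<^bsub>F\<^esub> (a \<otimes>\<^bsub>F\<^esub> b)"
      using S.m_assoc[of "a [^]\<^bsub>?S\<^esub> i" a b] S.nat_pow_closed[of a i] a Suc.prems S_simps by simp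
    also have "\<dots> = a [^]\<^bsub>F\<^esub> i \<otimes>\<^bsub>F\<^esub> (a \<otimes>\<^bsub>F\<^esub> b)" using ab by (rule Suc.IH)
    also have "\<dots> = a [^]\<^bsub>F\<^esub> Suc i \<otimes>\<^bsub>F\<^esub> b"
      using a Suc.prems MF by (simp add: F.m_assoc subset_iff)
    finally show ?case .
  qed
qed

lemma (in monoid) Rtilde_le_mult_right:
  assumes "E \<subseteq> carrier G" "x \<in> carrier G" "c \<in> carrier G"
  shows "Rtilde_le G E (x \<otimes> c) x"
  using assms by (auto simp: Rtilde_le_def simp flip: m_assoc)

theorem theorem4p4:
  fixes F :: "('a, 'm) monoid_scheme" (structure)
    and E M :: "'a set" and u :: 'a
  assumes F: "left_Ehresmann F E"
    and M: "monoid_subsemigroup F M u"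
    and star: "\<exists>star. (\<forall>x\<in>carrier F. star x \<in> E) \<and>
      (\<forall>t\<in>M. \<forall>x\<in>M. \<forall>e. e = t \<otimes> x \<and> e = e \<otimes> e \<and> e \<in> E \<longrightarrow>
         e = Eplus F E t \<otimes> star x)"
    and cancel: "\<forall>t\<in>M. \<forall>x\<in>M. \<forall>s\<in>M. \<forall>w\<in>M.
      t \<otimes> x \<in> E \<and> w \<otimes> t = w \<otimes> s \<longrightarrow> s \<otimes> x \<in> E"
    and ab: "\<exists>a\<in>M. \<exists>b\<in>M.
      (\<forall>(i::nat) j. i \<noteq> j \<longrightarrow>
         \<not> Rtilde_le F E (a [^] i \<otimes> b) (a [^] j \<otimes> b)) \<and>
      (\<forall>i::nat. M \<inter>
         ({f \<in> E. a [^] Suc i \<otimes> b \<otimes> f = a [^] Suc i \<otimes> b} -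
          {f \<in> E. a [^] i \<otimes> b \<otimes> f = a [^] i \<otimes> b}) \<noteq> {}) \<and>
      (\<forall>i::nat. \<forall>s\<in>M. \<forall>t\<in>M.
         a [^] i \<otimes> b \<otimes> s = a [^] i \<otimes> b \<otimes> t \<and>
         a [^] i \<otimes> b \<otimes> Eplus F E t = a [^] i \<otimes> b \<longrightarrow>
         a [^] i \<otimes> b \<otimes> Eplus F E s = a [^] i \<otimes> b)"
  shows "\<not> right_coherent (submonoid_with_one F M u)"
proof -
  let ?S = "submonoid_with_one F M u"
  interpret left_Ehresmann F E by (rule F)
  have S: "monoid ?S" and MF: "M \<subseteq> carrier F"
    using M by (simp_all add: monoid_subsemigroup_def)
  have S_simps: "carrier ?S = M" "mult ?S = mult F" by (simp_all add: submonoid_with_one_def)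
  obtain a b where a: "a \<in> M" and b: "b \<in> M"
    and incomparable: "\<forall>(i::nat) j. i \<noteq> j \<longrightarrow>
      \<not> Rtilde_le F E (a [^] i \<otimes> b) (a [^] j \<otimes> b)"
    and growing: "\<forall>i::nat. M \<inter>
         ({f \<in> E. a [^] Suc i \<otimes> b \<otimes> f = a [^] Suc i \<otimes> b} -
          {f \<in> E. a [^] i \<otimes> b \<otimes> f = a [^] i \<otimes> b}) \<noteq> {}"
    using ab by (elim bexE conjE) (rule that)
  have pow: "a [^]\<^bsub>?S\<^esub> i \<otimes>\<^bsub>?S\<^esub> b = a [^] i \<otimes> b" for i :: nat
    using submonoid_pow_mult[OF monoid_axioms M a b] S_simps by simp
  show ?thesis
  proof (rule not_right_coherent_if_powers[OF S, of a b])
    show "m = n"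
      if "c \<in> carrier ?S" and "a [^]\<^bsub>?S\<^esub> n \<otimes>\<^bsub>?S\<^esub> b = a [^]\<^bsub>?S\<^esub> m \<otimes>\<^bsub>?S\<^esub> b \<otimes>\<^bsub>?S\<^esub> c"
      for m n :: nat and c
    proof (rule ccontr)
      assume "m \<noteq> n"
      have "c \<in> carrier F" "a [^] m \<otimes> b \<in> carrier F" using that(1) a b MF S_simps by auto
      then have "Rtilde_le F E (a [^] m \<otimes> b \<otimes> c) (a [^] m \<otimes> b)"
        using E_subset Rtilde_le_mult_right by blast
      moreover have "a [^] n \<otimes> b = a [^] m \<otimes> b \<otimes> c" using that(2) unfolding pow unfolding S_simps .
      ultimately show False using incomparable[rule_format, of n m] \<open>m \<noteq> n\<close> by simp
    qed
    show "\<exists>f\<in>carrier ?S. a [^]\<^bsub>?S\<^esub> Suc n \<otimes>\<^bsub>?S\<^esub> b \<otimes>\<^bsub>?S\<^esub> f = a [^]\<^bsub>?S\<^esub> Suc n \<otimes>\<^bsub>?S\<^esub> b \<and>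
        a [^]\<^bsub>?S\<^esub> n \<otimes>\<^bsub>?S\<^esub> b \<otimes>\<^bsub>?S\<^esub> f \<noteq> a [^]\<^bsub>?S\<^esub> n \<otimes>\<^bsub>?S\<^esub> b" for n :: nat
    proof -
      obtain f where "f \<in> M" "a [^] Suc n \<otimes> b \<otimes> f = a [^] Suc n \<otimes> b"
          "a [^] n \<otimes> b \<otimes> f \<noteq> a [^] n \<otimes> b"
        using growing[rule_format, of n] by (auto simp del: nat_pow_Suc)
      then show ?thesis unfolding pow unfolding S_simps by metis
    qed
  qed (use a b S_simps in simp_all)
qed

end
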